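(* Let $I$ be a finite set and $T$ a tree on $I$. For $i\in I$, define the rational differential $1$-form on $\mathbb{C}^I$ $$\omega_i=\sum_{j\leq_T i}\Big(\prod_{k\leq_T i,\ k\neq j}\frac{1}{x_k-x_j}\Big)dx_j .$$ Then, for every $i\in I$, $\omega_i$ is a logarithmic $1$-form for $H_T$.
   Context: A tree on a finite set $I$ is a labeled rooted tree with vertex set $I$; equivalently, a partial order $\leq_T$ on $I$ with a unique minimal element (the root) such that the interval between the root and any element is a chain. $\mathbb{C}^I$ has coordinates $x_i$. $H_T$ is the hyperplane arrangement in $\mathbb{C}^I$ consisting of the hyperplanes $x_i=x_j$ for $i<_T j$, and $\mathsf{Q}_T=\prod_{i<_T j}(x_i-x_j)$ is its defining form. A differential form $\omega$ with coefficients in the field of rational functions on $\mathbb{C}^I$ is a logarithmic differential form for $H_T$ if $\mathsf{Q}_T\,\omega$ and $\mathsf{Q}_T\,d\omega$ are polynomial forms on $\mathbb{C}^I$. *)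

theory Defs
  imports
    "HOL-Library.Poly_Mapping"
    "HOL-Computational_Algebra.Polynomial_Factorial"
begin

text \<open>
  Polynomials are finitely supported maps from exponent vectors to coefficients. The library
  proves that these form an integral domain only for linearly ordered variables, so the index
  is wrapped in a copy that carries some (arbitrarily chosen) linear order. That order serves
  only to obtain the type class instance; no definition below refers to it.
\<close>

datatype 'i var = X 'i

definition some_linear_order :: "'i var rel" where
  "some_linear_order = (SOME r. linear_order_on UNIV r)"

lemma linear_order_some_linear_order: "linear_order_on UNIV some_linear_order"
proof -
  have "\<exists>r. linear_order_on UNIV (r :: 'i var rel)"
    using well_order_on[of UNIV] unfolding well_order_on_def by blast
  then show ?thesis
    unfolding some_linear_order_def by (rule someI_ex)
qed

instantiation var :: (type) linorder
begin

definition less_eq_var :: "'a var \<Rightarrow> 'a var \<Rightarrow> bool" where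
  "less_eq_var x y \<longleftrightarrow> (x, y) \<in> some_linear_order"

definition less_var :: "'a var \<Rightarrow> 'a var \<Rightarrow> bool" where
  "less_var x y \<longleftrightarrow> (x, y) \<in> some_linear_order \<and> x \<noteq> y"

instance
proof -
  note lo = linear_order_some_linear_order[where ?'a = 'a]
  from lo have r: "refl (some_linear_order :: 'a var rel)" and t: "trans (some_linear_order :: 'a var rel)"
    and a: "antisym (some_linear_order :: 'a var rel)" and tot: "total (some_linear_order :: 'a var rel)"
    by (simp_all add: order_on_defs)
  show "OFCLASS('a var, linorder_class)"
    apply standard
    subgoal unfolding less_eq_var_def less_var_def using a by (auto dest: antisymD)
    subgoal unfolding less_eq_var_def using r by (auto dest: refl_onD)
    subgoal unfolding less_eq_var_def using t by (auto dest: transD)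
    subgoal unfolding less_eq_var_def using a by (auto dest: antisymD)
    subgoal for x y unfolding less_eq_var_def using tot r
      by (cases "x = y") (auto simp: total_on_def dest: refl_onD)
    done
qed

end

type_synonym 'i mpoly = "('i var \<Rightarrow>\<^sub>0 nat) \<Rightarrow>\<^sub>0 complex"
type_synonym 'i ratfun = "'i mpoly fract"

definition coord :: "'i \<Rightarrow> 'i mpoly" where
  "coord i = Poly_Mapping.single (Poly_Mapping.single (X i) 1) 1"

text \<open>
  The partial derivative: the coefficient of the monomial \<open>m\<close> in \<open>\<partial>p/\<partial>x\<^sub>i\<close> is \<open>m\<^sub>i + 1\<close> times the
  coefficient of \<open>x\<^sub>i m\<close> in \<open>p\<close>.
\<close>

lift_definition pdiff :: "'i \<Rightarrow> 'i mpoly \<Rightarrow> 'i mpoly" is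
  "\<lambda>i p m. of_nat (Poly_Mapping.lookup m (X i) + 1) * p (m + Poly_Mapping.single (X i) 1)"
proof -
  fix i :: 'i and p :: "('i var \<Rightarrow>\<^sub>0 nat) \<Rightarrow> complex"
  let ?g = "\<lambda>m. m + Poly_Mapping.single (X i) (1::nat)"
  assume "finite {m. p m \<noteq> 0}"
  then have "finite (?g -` {m. p m \<noteq> 0})"
    by (rule finite_vimageI) (simp add: inj_on_def)
  then show "finite {m. of_nat (Poly_Mapping.lookup m (X i) + 1) * p (?g m) \<noteq> 0}"
    by (rule rev_finite_subset) auto
qed

lemma pdiff_zero [simp]: "pdiff i 0 = 0"
  by transfer simp

lemma pdiff_add: "pdiff i (p + q) = pdiff i p + pdiff i q"
  by transfer (simp add: algebra_simps)

lemma pdiff_single: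
  "pdiff i (Poly_Mapping.single m c) =
     Poly_Mapping.single (m - Poly_Mapping.single (X i) 1) (of_nat (Poly_Mapping.lookup m (X i)) * c)"
proof (rule poly_mapping_eqI)
  fix k
  let ?e = "Poly_Mapping.single (X i) (1::nat)"
  have 1: "m = k + ?e \<longleftrightarrow> k = m - ?e \<and> Poly_Mapping.lookup m (X i) \<noteq> 0"
  proof
    assume "k = m - ?e \<and> Poly_Mapping.lookup m (X i) \<noteq> 0"
    then show "m = k + ?e"
      by (intro poly_mapping_eqI) (auto simp: lookup_add lookup_minus lookup_single when_def)
  qed (simp add: lookup_add)
  have 2: "Poly_Mapping.lookup m (X i) = Poly_Mapping.lookup k (X i) + 1" if "m = k + ?e"
    using that by (simp add: lookup_add)
  show "Poly_Mapping.lookup (pdiff i (Poly_Mapping.single m c)) k =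
        Poly_Mapping.lookup (Poly_Mapping.single (m - ?e) (of_nat (Poly_Mapping.lookup m (X i)) * c)) k"
    using 1 2 by (auto simp: pdiff.rep_eq lookup_single when_def)
qed

lemma pdiff_mult_single:
  "pdiff i (Poly_Mapping.single m c * Poly_Mapping.single n d) =
     pdiff i (Poly_Mapping.single m c) * Poly_Mapping.single n d +
     Poly_Mapping.single m c * pdiff i (Poly_Mapping.single n d)"
proof -
  let ?e = "Poly_Mapping.single (X i) (1::nat)"
  have 1: "m - ?e + n = m + n - ?e" if "Poly_Mapping.lookup m (X i) \<noteq> 0" for m n :: "'a var \<Rightarrow>\<^sub>0 nat"
    using that
    by (intro poly_mapping_eqI) (auto simp: lookup_add lookup_minus lookup_single when_def)
  have 2: "Poly_Mapping.single (m - ?e + n) (of_nat (Poly_Mapping.lookup m (X i)) * z) =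
           Poly_Mapping.single (m + n - ?e) (of_nat (Poly_Mapping.lookup m (X i)) * z)"
    for m n :: "'a var \<Rightarrow>\<^sub>0 nat" and z :: complex
    using 1[of m n] by (cases "Poly_Mapping.lookup m (X i) = 0") simp_all
  show ?thesis
    using 2[of m n "c * d"] 2[of n m "c * d"]
    by (simp add: pdiff_single mult_single lookup_add single_add[symmetric] algebra_simps)
qed

lemma mpoly_induct [case_names zero add_single]:
  fixes p :: "'i mpoly"
  assumes "P 0" and "\<And>p m c. P p \<Longrightarrow> P (p + Poly_Mapping.single m c)"
  shows "P p"
proof (induction p rule: update_induct)
  case (update f a b)
  have "Poly_Mapping.update a b f = f + Poly_Mapping.single a b"
    using update(1)
    by (intro poly_mapping_eqI) (auto simp: lookup_update lookup_add lookup_single when_def in_keys_iff)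
  with assms(2) update(3) show ?case by simp
qed (rule assms)

lemma pdiff_mult: "pdiff i (p * q) = pdiff i p * q + p * pdiff i q"
proof -
  have 1: "pdiff i (Poly_Mapping.single m c * q) =
    pdiff i (Poly_Mapping.single m c) * q + Poly_Mapping.single m c * pdiff i q" for m c
    by (induction q rule: mpoly_induct)
       (simp_all add: pdiff_mult_single pdiff_add algebra_simps)
  show ?thesis
  proof (induction p rule: mpoly_induct)
    case (add_single p m c)
    have "pdiff i ((p + Poly_Mapping.single m c) * q) =
          pdiff i (p * q) + pdiff i (Poly_Mapping.single m c * q)"
      by (simp only: distrib_right pdiff_add)
    also have "\<dots> = (pdiff i p * q + p * pdiff i q) +
        (pdiff i (Poly_Mapping.single m c) * q + Poly_Mapping.single m c * pdiff i q)"
      by (simp only: add_single 1)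
    finally show ?case
      by (simp only: distrib_right pdiff_add add_ac)
  qed simp
qed

lemma quotient_rule_well_defined:
  fixes a b c d a' b' c' d' :: "'r::comm_ring_1"
  assumes "a * d = c * b" and "a' * d + a * d' = c' * b + c * b'"
  shows "(a' * b - a * b') * (d * d) = (c' * d - c * d') * (b * b)"
proof -
  have "(a' * b - a * b') * (d * d) = b * d * (a' * d + a * d') - (a * d) * (b' * d + b * d')"
    by (simp add: algebra_simps)
  also have "\<dots> = (c' * d - c * d') * (b * b)"
    unfolding assms by (simp add: algebra_simps)
  finally show ?thesis .
qed

text \<open>The quotient rule; \<open>rdiff_Fract\<close> shows that it does not depend on the representation.\<close>

definition rdiff :: "'i \<Rightarrow> 'i ratfun \<Rightarrow> 'i ratfun" where
  "rdiff i f = (THE g. \<exists>a b. b \<noteq> 0 \<and> f = Fract a b \<and>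
                  g = Fract (pdiff i a * b - a * pdiff i b) (b * b))"

lemma rdiff_Fract:
  assumes "b \<noteq> 0"
  shows "rdiff i (Fract a b) = Fract (pdiff i a * b - a * pdiff i b) (b * b)"
  unfolding rdiff_def
proof (rule the_equality)
  show "\<exists>c d. d \<noteq> 0 \<and> Fract a b = Fract c d \<and>
          Fract (pdiff i a * b - a * pdiff i b) (b * b) = Fract (pdiff i c * d - c * pdiff i d) (d * d)"
    using assms by blast
next
  fix g
  assume "\<exists>c d. d \<noteq> 0 \<and> Fract a b = Fract c d \<and> g = Fract (pdiff i c * d - c * pdiff i d) (d * d)"
  then obtain c d where d: "d \<noteq> 0" and e: "Fract a b = Fract c d"
    and g: "g = Fract (pdiff i c * d - c * pdiff i d) (d * d)" by blast
  have 1: "a * d = c * b"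
    using e by (rule iffD1[OF eq_fract(1)[OF assms d]])
  have 2: "pdiff i a * d + a * pdiff i d = pdiff i c * b + c * pdiff i b"
    using arg_cong[OF 1, of "pdiff i"] by (simp only: pdiff_mult)
  have "Fract (pdiff i a * b - a * pdiff i b) (b * b) = Fract (pdiff i c * d - c * pdiff i d) (d * d)"
    using quotient_rule_well_defined[OF 1 2]
    by (rule iffD2[OF eq_fract(1)[OF no_zero_divisors[OF assms assms] no_zero_divisors[OF d d]]])
  then show "g = Fract (pdiff i a * b - a * pdiff i b) (b * b)"
    unfolding g by (rule sym)
qed

abbreviation xcoord :: "'i \<Rightarrow> 'i ratfun" where
  "xcoord i \<equiv> to_fract (coord i)"

text \<open>
  A \<open>p\<close>-form is given by its values on coordinate vector fields: \<open>\<omega> [i\<^sub>1, \<dots>, i\<^sub>p]\<close> is the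
  coefficient of \<open>dx\<^sub>i\<^sub>1 \<and> \<dots> \<and> dx\<^sub>i\<^sub>p\<close>, extended alternatingly to all index lists, and \<open>0\<close>
  on lists of any other length.
\<close>

type_synonym 'i form = "'i list \<Rightarrow> 'i ratfun"

definition is_form :: "nat \<Rightarrow> 'i form \<Rightarrow> bool" where
  "is_form p \<omega> \<longleftrightarrow>
     (\<forall>is. length is \<noteq> p \<or> \<not> distinct is \<longrightarrow> \<omega> is = 0) \<and>
     (\<forall>is a b. a < b \<and> b < length is \<longrightarrow> \<omega> (is[a := is ! b, b := is ! a]) = - \<omega> is)"

definition scale_form :: "'i ratfun \<Rightarrow> 'i form \<Rightarrow> 'i form" where
  "scale_form f \<omega> = (\<lambda>is. f * \<omega> is)"

definition ext_d :: "'i form \<Rightarrow> 'i form" where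
  "ext_d \<omega> = (\<lambda>is. \<Sum>k<length is. (-1) ^ k * rdiff (is ! k) (\<omega> (take k is @ drop (Suc k) is)))"

definition dx :: "'i \<Rightarrow> 'i form" where
  "dx j = (\<lambda>is. if is = [j] then 1 else 0)"

definition polynomial_form :: "'i form \<Rightarrow> bool" where
  "polynomial_form \<omega> \<longleftrightarrow> (\<forall>is. \<omega> is \<in> range to_fract)"

lemma rdiff_zero [simp]: "rdiff i 0 = 0"
  by (simp add: Zero_fract_def rdiff_Fract eq_fract)

lemma pdiff_one [simp]: "pdiff i 1 = 0"
  using pdiff_single[of i 0 1] by simp

lemma rdiff_to_fract: "rdiff i (to_fract p) = to_fract (pdiff i p)"
  by (simp add: to_fract_def rdiff_Fract)

lemma pdiff_coord: "pdiff i (coord j) = (if i = j then 1 else 0)"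
  by (simp add: coord_def pdiff_single lookup_single when_def)

lemma dx_eq_ext_d: "dx j = ext_d (\<lambda>is. if is = [] then xcoord j else 0)"
proof
  fix "is" :: "'a list"
  show "dx j is = ext_d (\<lambda>is. if is = [] then xcoord j else 0) is"
  proof (cases "length is = 1")
    case True
    then obtain a where "is = [a]" by (cases "is") auto
    then show ?thesis
      by (simp add: dx_def ext_d_def rdiff_to_fract pdiff_coord)
  next
    case False
    then have "take k is @ drop (Suc k) is \<noteq> []" if "k < length is" for k
      using that by auto
    then have "(-1) ^ k * rdiff (is ! k) (if take k is @ drop (Suc k) is = [] then xcoord j else 0) = 0"
      if "k < length is" for k
      using that by (simp only: if_False rdiff_zero mult_zero_right)
    then have "ext_d (\<lambda>is. if is = [] then xcoord j else 0) is = 0"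
      unfolding ext_d_def by (intro sum.neutral) blast
    with False show ?thesis
      by (auto simp: dx_def)
  qed
qed

lemma ext_d_1form: "ext_d \<omega> [a, b] = rdiff a (\<omega> [b]) - rdiff b (\<omega> [a])"
  by (simp add: ext_d_def numeral_2_eq_2)

text \<open>A tree on the finite set \<open>UNIV :: 'i set\<close>; \<open>(i, j) \<in> T\<close> stands for \<open>i \<le>\<^sub>T j\<close>.\<close>

definition minimal_in :: "'i rel \<Rightarrow> 'i \<Rightarrow> bool" where
  "minimal_in T r \<longleftrightarrow> (\<forall>v. (v, r) \<in> T \<longrightarrow> v = r)"

definition is_tree :: "('i::finite) rel \<Rightarrow> bool" where
  "is_tree T \<longleftrightarrow> partial_order_on UNIV T \<and> (\<exists>!r. minimal_in T r) \<and>
     (\<forall>r v. minimal_in T r \<longrightarrow> {u. (r, u) \<in> T \<and> (u, v) \<in> T} \<in> Chains T)"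

text \<open>
  The arrangement of \<open>T\<close> consists of the hyperplanes \<open>x\<^sub>i = x\<^sub>j\<close> with \<open>i <\<^sub>T j\<close>;
  it enters through its defining form \<open>Q\<^sub>T\<close>.
\<close>

definition defining_form :: "('i::finite) rel \<Rightarrow> 'i mpoly" where
  "defining_form T = (\<Prod>(i, j) \<in> {(i, j). (i, j) \<in> T \<and> i \<noteq> j}. coord i - coord j)"

definition logarithmic_form :: "('i::finite) rel \<Rightarrow> nat \<Rightarrow> 'i form \<Rightarrow> bool" where
  "logarithmic_form T p \<omega> \<longleftrightarrow> is_form p \<omega> \<and>
     polynomial_form (scale_form (to_fract (defining_form T)) \<omega>) \<and>
     polynomial_form (scale_form (to_fract (defining_form T)) (ext_d \<omega>))"

definition tree_form :: "('i::finite) rel \<Rightarrow> 'i \<Rightarrow> 'i form" where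
  "tree_form T i = (\<lambda>is. \<Sum>j | (j, i) \<in> T.
     scale_form (\<Prod>k | (k, i) \<in> T \<and> k \<noteq> j. 1 / (xcoord k - xcoord j)) (dx j) is)"

end

theory Submission
  imports Defs
begin

text \<open>
  The elements below \<open>i\<close> form a chain \<open>C\<close>, so for each pair of distinct elements of \<open>C\<close> the
  defining form contains the corresponding difference of coordinates exactly once, up to sign.
  In particular it is divisible by the denominators of \<open>\<omega>\<^sub>i\<close>. The \<open>dx\<^sub>a \<and> dx\<^sub>b\<close>-coefficient of
  \<open>d\<omega>\<^sub>i\<close> vanishes unless \<open>a, b \<in> C\<close>. With \<open>P\<^sub>c = \<Prod>(x\<^sub>k - x\<^sub>c)\<close>, the product over
  \<open>k \<in> C - {a, b}\<close>, it then equals \<open>(P\<^sub>b - P\<^sub>a) / ((x\<^sub>a - x\<^sub>b)\<^sup>2 P\<^sub>a P\<^sub>b)\<close>. Since \<open>x\<^sub>a - x\<^sub>b\<close> divides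
  \<open>P\<^sub>b - P\<^sub>a\<close>, the denominator reduces to \<open>(x\<^sub>a - x\<^sub>b) P\<^sub>a P\<^sub>b\<close>, a product over distinct pairs.
\<close>

section \<open>Derivatives, divisibility and fractions\<close>

lemma pdiff_diff: "pdiff i (p - q) = pdiff i p - pdiff i q"
  using pdiff_add[of i "p - q" q] by (simp add: eq_diff_eq)

lemma pdiff_prod_eq_0:
  assumes "\<And>k. k \<in> A \<Longrightarrow> pdiff i (f k) = 0"
  shows "pdiff i (\<Prod>k\<in>A. f k) = 0"
  using assms by (induction A rule: infinite_finite_induct) (simp_all add: pdiff_mult)

text \<open>The derivative in the direction of \<open>j\<close> separates the coordinates. This is
  what makes the differences in all denominators nonzero.\<close>

lemma coord_eq_iff: "coord j = coord k \<longleftrightarrow> j = k"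
proof
  assume "coord j = coord k"
  then have "pdiff j (coord j) = pdiff j (coord k)" by simp
  then show "j = k" by (simp add: pdiff_coord split: if_splits)
qed simp

text \<open>With \<open>F(t)\<close> the product of the \<open>f k - t\<close>, this is the
  divisibility of \<open>F(v) - F(u)\<close> by \<open>u - v\<close>. It supplies the cancellation
  that lowers the pole order of \<open>d\<omega>\<^sub>i\<close> along
  \<open>x\<^sub>a = x\<^sub>b\<close> from 2 to 1.\<close>

lemma dvd_diff_prod_diff:
  fixes u v :: "'a::comm_ring_1"
  shows "u - v dvd (\<Prod>k\<in>A. f k - v) - (\<Prod>k\<in>A. f k - u)"
proof (induction A rule: infinite_finite_induct)
  case (insert a A)
  have "(\<Prod>k\<in>insert a A. f k - v) - (\<Prod>k\<in>insert a A. f k - u) =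
      (f a - v) * ((\<Prod>k\<in>A. f k - v) - (\<Prod>k\<in>A. f k - u)) + (u - v) * (\<Prod>k\<in>A. f k - u)"
    using insert.hyps by (simp add: algebra_simps)
  then show ?case using insert.IH by simp
qed simp_all

lemma to_fract_prod: "to_fract (\<Prod>k\<in>A. f k) = (\<Prod>k\<in>A. to_fract (f k))"
  by (induction A rule: infinite_finite_induct) simp_all

text \<open>The cofactor of \<open>n\<close> in \<open>q\<close> clears the denominator, so both
  polynomiality conditions reduce to divisibility of the defining form.\<close>

lemma to_fract_mult_divide_in_range:
  fixes q n w :: "'a::idom"
  assumes "n \<noteq> 0" "n dvd q"
  shows "to_fract q * (to_fract w / to_fract n) \<in> range to_fract"
proof -
  obtain c where "q = n * c" using assms(2) by blast
  then have "to_fract q * (to_fract w / to_fract n) = to_fract (c * w)"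
    using assms(1) by simp
  then show ?thesis by blast
qed

lemma rdiff_inverse:
  assumes "n \<noteq> 0"
  shows "rdiff a (1 / to_fract n) = - to_fract (pdiff a n) / (to_fract n * to_fract n)"
proof -
  have "rdiff a (1 / to_fract n) = rdiff a (Fract 1 n)"
    by (simp add: to_fract_def One_fract_def)
  also have "\<dots> = Fract (- pdiff a n) (n * n)"
    using assms by (simp add: rdiff_Fract)
  also have "\<dots> = - to_fract (pdiff a n) / (to_fract n * to_fract n)"
    by (simp add: to_fract_def)
  finally show ?thesis .
qed

section \<open>The elements below a vertex\<close>

lemma minimal_below:
  fixes T :: "('i::finite) rel"
  assumes "partial_order_on UNIV T"
  shows "\<exists>m. minimal_in T m \<and> (m, v) \<in> T"
\<comment> \<open>Finite descent: passing to some \<open>w\<close> strictly below \<open>v\<close>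
  loses at least \<open>v\<close> itself from the set of elements below.\<close>
proof (induction "card {u. (u, v) \<in> T}" arbitrary: v rule: less_induct)
  case less
  have refl: "(x, x) \<in> T" for x
    using assms by (auto simp: order_on_defs dest: refl_onD)
  have trans: "(x, z) \<in> T" if "(x, y) \<in> T" "(y, z) \<in> T" for x y z
    using assms that by (auto simp: order_on_defs dest: transD)
  have antisym: "x = y" if "(x, y) \<in> T" "(y, x) \<in> T" for x y
    using assms that by (auto simp: order_on_defs dest: antisymD)
  show ?case
  proof (cases "minimal_in T v")
    case True
    then show ?thesis using refl by blast
  next
    case False
    then obtain w where w: "(w, v) \<in> T" "w \<noteq> v" by (auto simp: minimal_in_def)
    have "{u. (u, w) \<in> T} \<subset> {u. (u, v) \<in> T}"
      using w refl trans antisym by blast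
    then have "card {u. (u, w) \<in> T} < card {u. (u, v) \<in> T}"
      by (simp add: psubset_card_mono)
    from less[OF this] show ?thesis using w trans by blast
  qed
qed

text \<open>The root lies below every vertex, so the interval from the root to \<open>i\<close>, a
  chain by definition, contains everything below \<open>i\<close>.\<close>

lemma tree_below_comparable:
  assumes "is_tree T" "(j, i) \<in> T" "(k, i) \<in> T"
  shows "(j, k) \<in> T \<or> (k, j) \<in> T"
proof -
  have po: "partial_order_on UNIV T" using assms by (simp add: is_tree_def)
  have "\<exists>!r. minimal_in T r" using assms(1) by (simp add: is_tree_def)
  then obtain r where r: "minimal_in T r" "\<And>m. minimal_in T m \<Longrightarrow> m = r"
    by (rule ex1E) blast
  have "(r, v) \<in> T" for v
    using minimal_below[OF po, of v] r by blast
  moreover have "{u. (r, u) \<in> T \<and> (u, i) \<in> T} \<in> Chains T"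
    using assms(1) r(1) by (simp add: is_tree_def)
  ultimately show ?thesis using assms by (auto simp: Chains_def)
qed

text \<open>The first assumption excludes diagonal pairs and pairs occurring in both orders. Turning
  every pair into the order of \<open>T\<close> is therefore injective on \<open>A\<close>; it
  changes factors only by signs and yields a subproduct of the defining form.\<close>

lemma prod_coord_diff_dvd_defining_form:
  fixes T :: "('i::finite) rel"
  assumes "A \<inter> A\<inverse> = {}" "A \<subseteq> T \<union> T\<inverse>"
  shows "(\<Prod>(j, k)\<in>A. coord j - coord k) dvd defining_form T"
proof -
  define orient where "orient = (\<lambda>p. if p \<in> T then p else prod.swap p)"
  have ne: "j \<noteq> k" if "(j, k) \<in> A" for j k using that assms(1) by blast
  have inj: "inj_on orient A"
  proof (rule inj_onI)
    fix p q assume pq: "p \<in> A" "q \<in> A" "orient p = orient q"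
    have "q \<noteq> prod.swap p" using pq assms(1) by (cases p) auto
    moreover have "q = p \<or> q = prod.swap p"
      using pq(3) by (cases p, cases q) (auto simp: orient_def split: if_splits)
    ultimately show "p = q" by simp
  qed
  have "(\<Prod>(j, k)\<in>A. coord j - coord k) dvd
      (\<Prod>p\<in>A. case orient p of (j, k) \<Rightarrow> coord j - coord k)"
  proof (rule prod_dvd_prod)
    fix p assume "p \<in> A"
    obtain j k where p: "p = (j, k)" by (cases p)
    have "coord j - coord k dvd coord k - coord j"
      by (metis dvd_minus_iff dvd_refl minus_diff_eq)
    then show "(case p of (j, k) \<Rightarrow> coord j - coord k) dvd
        (case orient p of (j, k) \<Rightarrow> coord j - coord k)"
      by (auto simp: p orient_def)
  qed
  also have "\<dots> = (\<Prod>(j, k)\<in>orient ` A. coord j - coord k)"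
    by (simp add: prod.reindex[OF inj] o_def)
  also have "\<dots> dvd defining_form T"
    unfolding defining_form_def
    by (rule prod_dvd_prod_subset) (use assms(2) ne in \<open>auto simp: orient_def\<close>)
  finally show ?thesis .
qed

section \<open>The coefficients of \<open>\<omega>\<^sub>i\<close> and their derivatives\<close>

lemma tree_form_eq_0:
  assumes "length is \<noteq> 1"
  shows "tree_form T i is = 0"
  unfolding tree_form_def scale_form_def dx_def
  by (rule sum.neutral) (use assms in auto)

definition tree_denom :: "('i::finite) rel \<Rightarrow> 'i \<Rightarrow> 'i \<Rightarrow> 'i mpoly" where
  "tree_denom T i b = (\<Prod>k | (k, i) \<in> T \<and> k \<noteq> b. coord k - coord b)"

lemma tree_denom_nonzero: "tree_denom T i b \<noteq> 0"
  by (simp add: tree_denom_def prod_zero_iff coord_eq_iff)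

lemma tree_form_singleton:
  "tree_form T i [b] = (if (b, i) \<in> T then 1 / to_fract (tree_denom T i b) else 0)"
proof -
  have "tree_form T i [b] = (\<Sum>j | (j, i) \<in> T. if j = b then 1 / to_fract (tree_denom T i b) else 0)"
    unfolding tree_form_def scale_form_def dx_def
    by (rule sum.cong) (simp_all add: tree_denom_def to_fract_prod prod_dividef)
  then show ?thesis by simp
qed

lemma is_form_tree_form: "is_form 1 (tree_form T i)"
proof -
  have "tree_form T i (is[a := is ! b, b := is ! a]) = - tree_form T i is"
    if "a < b" "b < length is" for a b "is"
    \<comment> \<open>Two distinct positions force length at least 2, where both sides
      vanish.\<close>
    using that by (subst (1 2) tree_form_eq_0) simp_all
  moreover have "tree_form T i is = 0" if "length is \<noteq> 1 \<or> \<not> distinct is" for "is"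
  proof (cases "length is = 1")
    case True
    then have "distinct is" by (cases "is") auto
    with True that show ?thesis by simp
  qed (rule tree_form_eq_0)
  ultimately show ?thesis by (simp add: is_form_def)
qed

lemma tree_denom_dvd_defining_form:
  assumes "is_tree T" "(b, i) \<in> T"
  shows "tree_denom T i b dvd defining_form T"
proof -
  let ?A = "{k. (k, i) \<in> T \<and> k \<noteq> b} \<times> {b}"
  have "(\<Prod>(j, k)\<in>?A. coord j - coord k) dvd defining_form T"
    by (rule prod_coord_diff_dvd_defining_form)
      (use tree_below_comparable[OF assms(1)] assms(2) in auto)
  then show ?thesis
    by (simp add: tree_denom_def prod.cartesian_product[symmetric])
qed

text \<open>Only the factor \<open>x\<^sub>a - x\<^sub>b\<close> of the denominator
  \<open>N = (x\<^sub>a - x\<^sub>b) P\<close> involves \<open>x\<^sub>a\<close>. Hence the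
  derivative of \<open>N\<close> is \<open>P\<close>, and one factor \<open>P\<close> cancels in
  \<open>- P / N\<^sup>2\<close>.\<close>

lemma rdiff_tree_form_below:
  assumes "(a, i) \<in> T" "(b, i) \<in> T" "a \<noteq> b"
  defines "P \<equiv> \<Prod>k | (k, i) \<in> T \<and> k \<noteq> a \<and> k \<noteq> b. coord k - coord b"
  shows "rdiff a (tree_form T i [b]) = - 1 / (to_fract (coord a - coord b) ^ 2 * to_fract P)"
    and "P \<noteq> 0"
proof -
  have "{k. (k, i) \<in> T \<and> k \<noteq> b} = insert a {k. (k, i) \<in> T \<and> k \<noteq> a \<and> k \<noteq> b}"
    using assms by auto
  then have N: "tree_denom T i b = (coord a - coord b) * P"
    by (simp add: tree_denom_def P_def)
  show P0: "P \<noteq> 0"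
    by (simp add: P_def prod_zero_iff coord_eq_iff)
  have "pdiff a P = 0"
    unfolding P_def by (rule pdiff_prod_eq_0) (use assms(3) in \<open>auto simp: pdiff_diff pdiff_coord\<close>)
  then have dN: "pdiff a (tree_denom T i b) = P"
    using assms(3) by (simp add: N pdiff_mult pdiff_diff pdiff_coord)
  have u0: "coord a - coord b \<noteq> 0" using assms(3) by (simp add: coord_eq_iff)
  have "rdiff a (tree_form T i [b]) =
      - to_fract P / (to_fract (tree_denom T i b) * to_fract (tree_denom T i b))"
    using assms(2) by (simp add: tree_form_singleton rdiff_inverse tree_denom_nonzero dN)
  also have "\<dots> = - 1 / (to_fract (coord a - coord b) ^ 2 * to_fract P)"
  proof -
    have "- p / ((u * p) * (u * p)) = - 1 / (u ^ 2 * p)" if "p \<noteq> 0" "u \<noteq> 0" for p u :: "'a ratfun"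
      using that by (simp add: power2_eq_square field_simps)
    with P0 u0 show ?thesis unfolding N to_fract_mult by (simp only: to_fract_eq_0_iff not_False_eq_True)
  qed
  finally show "rdiff a (tree_form T i [b]) = - 1 / (to_fract (coord a - coord b) ^ 2 * to_fract P)" .
qed

lemma rdiff_tree_form_not_below:
  assumes "(a, i) \<notin> T"
  shows "rdiff a (tree_form T i [b]) = 0"
proof (cases "(b, i) \<in> T")
  case True
  then have "a \<noteq> b" using assms by auto
  have "pdiff a (tree_denom T i b) = 0"
    unfolding tree_denom_def
    by (rule pdiff_prod_eq_0) (use assms \<open>a \<noteq> b\<close> in \<open>auto simp: pdiff_diff pdiff_coord\<close>)
  with True show ?thesis by (simp add: tree_form_singleton rdiff_inverse tree_denom_nonzero)
qed (simp add: tree_form_singleton)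

lemma ext_d_tree_form_coefficient:
  assumes T: "is_tree T" and ab: "(a, i) \<in> T" "(b, i) \<in> T" "a \<noteq> b"
  shows "to_fract (defining_form T) * ext_d (tree_form T i) [a, b] \<in> range to_fract"
proof -
  define K where "K = {k. (k, i) \<in> T \<and> k \<noteq> a \<and> k \<noteq> b}"
  define P where "P c = (\<Prod>k\<in>K. coord k - coord c)" for c
  define u where "u = coord a - coord b"
  have K': "{k. (k, i) \<in> T \<and> k \<noteq> b \<and> k \<noteq> a} = K" by (auto simp: K_def)
  have Pa0: "P a \<noteq> 0" and Pb0: "P b \<noteq> 0"
    by (auto simp: P_def K_def prod_zero_iff coord_eq_iff)
  have u0: "u \<noteq> 0" using ab by (simp add: u_def coord_eq_iff)
  have rb: "rdiff a (tree_form T i [b]) = - 1 / (to_fract u ^ 2 * to_fract (P b))"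
    using rdiff_tree_form_below(1)[of a i T b] ab by (simp add: u_def P_def K_def)
  \<comment> \<open>Exchanging \<open>a\<close> and \<open>b\<close> turns \<open>u\<close> into
    \<open>- u\<close>; the square absorbs the sign, so both derivatives share the factor
    \<open>u\<^sup>2\<close>.\<close>
  have "rdiff b (tree_form T i [a]) = - 1 / (to_fract (- u) ^ 2 * to_fract (P a))"
    using rdiff_tree_form_below(1)[of b i T a] ab by (simp add: u_def P_def K')
  then have ra: "rdiff b (tree_form T i [a]) = - 1 / (to_fract u ^ 2 * to_fract (P a))"
    by simp
  obtain w where w: "P b - P a = u * w"
    using dvd_diff_prod_diff[of "coord a" "coord b" coord K] by (auto simp: P_def u_def)
  have "ext_d (tree_form T i) [a, b] =
      to_fract (P b - P a) / (to_fract u ^ 2 * to_fract (P a) * to_fract (P b))"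
    using Pa0 Pb0 u0 by (simp add: ext_d_1form ra rb field_simps)
  also have "\<dots> = to_fract w / to_fract (u * P a * P b)"
    unfolding w using Pa0 Pb0 u0 by (simp add: field_simps power2_eq_square)
  finally have coeff: "ext_d (tree_form T i) [a, b] = to_fract w / to_fract (u * P a * P b)" .
  \<comment> \<open>One pair for each factor of \<open>u * P a * P b\<close>. As \<open>K\<close>
    omits \<open>a\<close> and \<open>b\<close>, no pair meets its reverse.\<close>
  let ?A = "insert (a, b) (K \<times> {a, b})"
  have "(\<Prod>(j, k)\<in>?A. coord j - coord k) dvd defining_form T"
    by (rule prod_coord_diff_dvd_defining_form)
      (use tree_below_comparable[OF T] ab in \<open>auto simp: K_def\<close>)
  also have "(\<Prod>(j, k)\<in>?A. coord j - coord k) = u * P a * P b"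
  proof -
    have "(a, b) \<notin> K \<times> {a, b}" by (simp add: K_def)
    then have "(\<Prod>(j, k)\<in>?A. coord j - coord k) = u * (\<Prod>(j, k)\<in>K \<times> {a, b}. coord j - coord k)"
      by (simp add: u_def)
    also have "\<dots> = u * (P a * P b)"
      using ab(3) by (simp add: P_def prod.cartesian_product[symmetric] prod.distrib)
    finally show ?thesis by (simp add: mult.assoc)
  qed
  finally have "u * P a * P b dvd defining_form T" .
  moreover have "u * P a * P b \<noteq> 0" using Pa0 Pb0 u0 by simp
  ultimately show ?thesis unfolding coeff by (intro to_fract_mult_divide_in_range)
qed

lemma zero_in_range_to_fract: "0 \<in> range to_fract"
  by (metis rangeI to_fract_0)

theorem proposition2:
  fixes T :: "('i::finite) rel" and i :: 'i
  assumes "is_tree T"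
  shows "logarithmic_form T 1 (tree_form T i)"
proof -
  let ?Q = "to_fract (defining_form T)"
  have "?Q * tree_form T i is \<in> range to_fract" for "is"
  proof (cases "length is = 1")
    case True
    then obtain b where b: "is = [b]" by (cases "is") auto
    show ?thesis
    proof (cases "(b, i) \<in> T")
      case True
      with to_fract_mult_divide_in_range[OF tree_denom_nonzero tree_denom_dvd_defining_form[OF assms True], of 1]
      show ?thesis by (simp add: b tree_form_singleton)
    next
      case False
      then show ?thesis by (simp add: b tree_form_singleton zero_in_range_to_fract)
    qed
  next
    case False
    then show ?thesis by (simp add: tree_form_eq_0 zero_in_range_to_fract)
  qed
  moreover have "?Q * ext_d (tree_form T i) is \<in> range to_fract" for "is"
  proof (cases "length is = 2")
    case True
    then obtain a b where ab: "is = [a, b]"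
      by (auto simp: numeral_2_eq_2 length_Suc_conv)
    show ?thesis
    proof (cases "(a, i) \<in> T \<and> (b, i) \<in> T \<and> a \<noteq> b")
      case True
      then show ?thesis using ext_d_tree_form_coefficient[OF assms] ab by blast
    next
      case False
      \<comment> \<open>For \<open>a = b\<close> the two derivatives cancel. An index not below
        \<open>i\<close> has zero coefficient, and the other coefficient is constant in its
        coordinate.\<close>
      then have "ext_d (tree_form T i) is = 0"
        by (cases "(a, i) \<in> T"; cases "(b, i) \<in> T")
          (auto simp: ab ext_d_1form rdiff_tree_form_not_below, simp_all add: tree_form_singleton)
      then show ?thesis by (simp add: zero_in_range_to_fract)
    qed
  next
    case False
    have "ext_d (tree_form T i) is = 0"
      unfolding ext_d_def
    proof (rule sum.neutral, rule ballI)
      fix k assume "k \<in> {..<length is}"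
      \<comment> \<open>Deleting one entry leaves a list of length 1 only if the length was
        2.\<close>
      with False have "length (take k is @ drop (Suc k) is) \<noteq> 1" by auto
      from tree_form_eq_0[OF this, of T i]
      show "(- 1) ^ k * rdiff (is ! k) (tree_form T i (take k is @ drop (Suc k) is)) = 0" by simp
    qed
    then show ?thesis by (simp add: zero_in_range_to_fract)
  qed
  ultimately show ?thesis
    by (simp add: logarithmic_form_def is_form_tree_form[unfolded One_nat_def] polynomial_form_def scale_form_def)
qed

end
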